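(* Let $n\geq 3$ and $1\leq \ell\leq n-2$ be integers, and let $\mathcal{U}_n^{1\not\sim F_\ell}$ be the set of uprooted trees with vertex set $[n]$ in which vertex $1$ is not adjacent to any vertex of $F_\ell=\{n-\ell+1,\ldots,n\}$. Then $$|\mathcal{U}_n^{1\not\sim F_\ell}| = (n-1)^{n-\ell-2}\,(n-2)^{\ell}\,(n-\ell-1).$$
   Context: $[n]=\{1,\ldots,n\}$. Trees are labeled trees with vertex set $[n]$. A rooted tree is a tree with a distinguished vertex, the root, with edges directed away from the root; the sons (children) of a vertex are defined accordingly. An uprooted tree is a rooted tree whose root is strictly larger than all of its sons. Adjacency means being joined by an edge of the tree. *)

theory Defs
  imports "Graph_Theory.Pair_Digraph" "Graph_Theory.Digraph_Component"
begin

text \<open>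
  A simple graph is, as in the AFP entry Graph_Theory, a finite loopfree symmetric digraph; in the
  arc-pair representation two such graphs are equal iff they have the same vertices and edges, so
  that counting them is counting labeled graphs.
  The constant \<^const>\<open>tree\<close> of that entry forbids directed cycles only: symmetric digraphs with an
  edge \<open>uv\<close> are never trees in that sense, because \<open>u, v, u\<close> is a directed cycle. Cycles of the
  underlying undirected graph are the directed cycles with at least three arcs.
\<close>

definition undirected_tree :: "'a pair_pre_digraph \<Rightarrow> bool" where
  "undirected_tree T \<longleftrightarrow> pair_graph T \<and> connected (with_proj T) \<and>
     \<not> (\<exists>p. pre_digraph.cycle (with_proj T) p \<and> length p \<ge> 3)"

definition labeled_trees :: "nat \<Rightarrow> nat pair_pre_digraph set" where
  "labeled_trees n = {T. undirected_tree T \<and> pverts T = {1..n}}"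

definition rooted_trees :: "nat \<Rightarrow> (nat pair_pre_digraph \<times> nat) set" where
  "rooted_trees n = {(T, r). T \<in> labeled_trees n \<and> r \<in> pverts T}"

text \<open>
  The edge joining \<open>u\<close> and \<open>v\<close> is directed from \<open>u\<close> to \<open>v\<close>, that is, away from the root \<open>r\<close>,
  iff it is the last edge of the path from \<open>r\<close> to \<open>v\<close>.
\<close>

definition sons :: "'a pair_pre_digraph \<Rightarrow> 'a \<Rightarrow> 'a \<Rightarrow> 'a set" where
  "sons T r u = {v. \<exists>p. pre_digraph.apath (with_proj T) r (p @ [(u, v)]) v}"

definition uprooted_trees :: "nat \<Rightarrow> (nat pair_pre_digraph \<times> nat) set" where
  "uprooted_trees n = {(T, r). (T, r) \<in> rooted_trees n \<and> (\<forall>v \<in> sons T r r. v < r)}"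

definition adjacent :: "'a pair_pre_digraph \<Rightarrow> 'a \<Rightarrow> 'a \<Rightarrow> bool" where
  "adjacent T u v \<longleftrightarrow> (u, v) \<in> parcs T"

definition last_labels :: "nat \<Rightarrow> nat \<Rightarrow> nat set" where
  "last_labels n l = {n - l + 1..n}"

definition uprooted_trees_avoiding :: "nat \<Rightarrow> nat \<Rightarrow> (nat pair_pre_digraph \<times> nat) set" where
  "uprooted_trees_avoiding n l =
     {(T, r). (T, r) \<in> uprooted_trees n \<and> (\<forall>v \<in> last_labels n l. \<not> adjacent T 1 v)}"

end

theory Submission
  imports Defs "HOL-Library.FuncSet"
begin

text \<open>
  Let \<open>M = {2..n}\<close> and let \<open>F\<close> be the set of the last \<open>l\<close> labels. Given an uprooted tree with root \<open>r\<close>, let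
  \<open>A \<subseteq> M\<close> consist of \<open>r\<close> and of its neighbours other than \<open>1\<close>. Then \<open>r = Max A\<close>, so that \<open>A\<close> tells where
  the root is; and every tree in which the neighbours of \<open>Max A\<close> other than \<open>1\<close> are the rest of \<open>A\<close> is
  uprooted at \<open>Max A\<close>, because an additional neighbour \<open>1\<close> does no harm
  (\<open>bij_betw_uprooted_trees_avoiding\<close>). The order of the labels has now disappeared: it remains to
  sum, over all nonempty \<open>A \<subseteq> M\<close>, the number \<open>P A\<close> of trees with the star \<open>A\<close> in which \<open>1\<close> has no
  neighbour in \<open>F\<close>.

  To compute \<open>P A\<close>, the trees are rooted at \<open>Max A\<close> and described by the map that sends a vertex to its
  parent. Once the parent of \<open>1\<close> is chosen, the vertices outside the star form a forest on
  \<open>W = M - A\<close> in which a vertex \<open>v\<close> has \<open>d v\<close> admissible parents, \<open>d v\<close> being \<open>n - 2\<close> on \<open>F\<close> and \<open>n - 1\<close>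
  elsewhere. There are two product formulas for such forests (\<open>card_parent_maps\<close> and
  \<open>card_parent_maps_exits_into\<close>): without further condition their number is
  \<open>(\<Prod>v\<in>W. d v) - (\<Sum>w\<in>W. \<Prod>v\<in>W - {w}. d v)\<close>, and if all vertices of \<open>W\<close> admit the same number \<open>a\<close> of
  parents among a set of roots, then \<open>a * (\<Prod>v\<in>W - {u}. d v)\<close> of them have \<open>u\<close> in a component with root in
  this set. As a result (\<open>card_trees_with_star\<close>), \<open>P A\<close> is
  \<open>card (A - F) * ((\<Prod>v\<in>W. d v) - (\<Sum>w\<in>W. \<Prod>v\<in>W - {w}. d v)) + (card A - 1) * (\<Sum>w\<in>W - F. \<Prod>v\<in>W - {w}. d v)\<close>.

  The sum of this expression over all subsets \<open>A\<close> of \<open>M\<close>, the empty one included, is zero for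
  arbitrary numbers \<open>d v\<close> (\<open>sum_over_subsets_vanishes\<close>). Therefore the sum over the nonempty ones is
  the negative of the value at \<open>A = {}\<close>, namely \<open>\<Sum>w\<in>M - F. \<Prod>v\<in>M - {w}. d v\<close>. Here each of the \<open>n - l - 1\<close>
  summands equals \<open>(n - 1) ^ (n - l - 2) * (n - 2) ^ l\<close>.
\<close>

section \<open>Paths of iterates\<close>

text \<open>
  The iteration of \<open>p\<close> that starts in \<open>v\<close> leaves \<open>V\<close>, and the first vertex outside \<open>V\<close> lies in \<open>Q\<close>.
  For \<open>Q = UNIV\<close> this says that the iteration does not run into a cycle inside \<open>V\<close>; for a set \<open>Q\<close> of
  roots it says in which components of a forest \<open>v\<close> lies. Only the values of \<open>p\<close> on \<open>V\<close> matter, so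
  that the junk value of an extensional \<open>p\<close> outside \<open>V\<close> is harmless.
\<close>

inductive exits_into :: "'a set \<Rightarrow> ('a \<Rightarrow> 'a) \<Rightarrow> 'a set \<Rightarrow> 'a \<Rightarrow> bool"
  for V :: "'a set" and p :: "'a \<Rightarrow> 'a" and Q :: "'a set" where
  outside: "v \<notin> V \<Longrightarrow> v \<in> Q \<Longrightarrow> exits_into V p Q v"
| inside: "v \<in> V \<Longrightarrow> exits_into V p Q (p v) \<Longrightarrow> exits_into V p Q v"

lemma exits_into_outside_iff: "v \<notin> V \<Longrightarrow> exits_into V p Q v \<longleftrightarrow> v \<in> Q"
  by (auto elim: exits_into.cases intro: outside)

lemma exits_into_inside_iff: "v \<in> V \<Longrightarrow> exits_into V p Q v \<longleftrightarrow> exits_into V p Q (p v)"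
  by (auto elim: exits_into.cases intro: inside)

lemma exits_into_mono: "exits_into V p Q v \<Longrightarrow> Q \<subseteq> R \<Longrightarrow> exits_into V p R v"
  by (induction rule: exits_into.induct) (auto intro: exits_into.intros)

lemma exits_into_cong:
  assumes "\<And>v. v \<in> V \<Longrightarrow> p v = q v"
  shows "exits_into V p Q x \<longleftrightarrow> exits_into V q Q x"
proof -
  have "exits_into V f Q x \<Longrightarrow> (\<And>v. v \<in> V \<Longrightarrow> f v = g v) \<Longrightarrow> exits_into V g Q x" for f g
    by (induction rule: exits_into.induct) (auto intro: exits_into.intros)
  with assms show ?thesis by metis
qed

lemma exits_into_Compl:
  assumes "exits_into V p UNIV v"
  shows "exits_into V p (- Q) v \<longleftrightarrow> \<not> exits_into V p Q v"
  using assms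
  by (induction rule: exits_into.induct) (auto simp: exits_into_outside_iff exits_into_inside_iff)

lemma not_exits_into_if_closed:
  assumes "Z \<subseteq> V" "p ` Z \<subseteq> Z" "z \<in> Z"
  shows "\<not> exits_into V p Q z"
proof -
  have "exits_into V p Q x \<Longrightarrow> x \<notin> Z" for x
    by (induction rule: exits_into.induct) (use assms in auto)
  with assms show ?thesis by auto
qed

lemma exits_into_insertI:
  assumes "exits_into V p (Q - {u}) x"
  shows "exits_into (insert u V) p Q x"
  using assms by (induction rule: exits_into.induct) (auto intro: exits_into.intros)

lemma exits_into_insert_cases:
  assumes "exits_into (insert u V) p Q x" "u \<notin> V"
  shows "exits_into V p (Q - {u}) x \<or> exits_into V p {u} x"
  using assms
  by (induction rule: exits_into.induct) (auto simp: exits_into_outside_iff exits_into_inside_iff)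

text \<open>
  A path from \<open>u\<close> that ends never comes back to \<open>u\<close>. So \<open>u\<close> can be moved out of \<open>V\<close>, provided that
  the path that starts at its successor does not stop at \<open>u\<close>.
\<close>

lemma exits_into_insert_self_iff:
  assumes "u \<notin> V"
  shows "exits_into (insert u V) p Q u \<longleftrightarrow> exits_into V p (Q - {u}) (p u)"
proof
  assume u: "exits_into (insert u V) p Q u"
  have "\<not> exits_into V p {u} (p u)"
  proof
    assume loop: "exits_into V p {u} (p u)"
    have no_return: "exits_into (insert u V) p Q x \<Longrightarrow> \<not> exits_into V p {u} x" for x
      by (induction rule: exits_into.induct)
        (use loop assms in \<open>auto simp: exits_into_outside_iff exits_into_inside_iff\<close>)
    show False using no_return[OF u] assms by (simp add: exits_into_outside_iff)
  qed
  with u show "exits_into V p (Q - {u}) (p u)"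
    using exits_into_insert_cases[of u V p Q "p u"] assms by (simp add: exits_into_inside_iff)
qed (auto simp: exits_into_inside_iff dest: exits_into_insertI)

section \<open>Forests with prescribed admissible parents\<close>

text \<open>
  These are the rooted forests on \<open>V\<close> with prescribed sets of admissible parents: a map sends a
  vertex to its parent, and the vertices outside \<open>V\<close> are the roots. The sets \<open>C v\<close> may contain
  elements of \<open>V\<close>, including \<open>v\<close>, as well as roots.
\<close>

definition parent_maps :: "'a set \<Rightarrow> ('a \<Rightarrow> 'a set) \<Rightarrow> ('a \<Rightarrow> 'a) set" where
  "parent_maps V C = {p \<in> Pi\<^sub>E V C. \<forall>v\<in>V. exits_into V p UNIV v}"

lemma finite_parent_maps:
  assumes "finite V" "\<And>v. v \<in> V \<Longrightarrow> finite (C v)"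
  shows "finite (parent_maps V C)"
  using finite_PiE[of V C] assms by (auto simp: parent_maps_def)

text \<open>
  Deleting the parent of \<open>u\<close> turns \<open>u\<close> into a further root. The parent \<open>y\<close> that was deleted can be any
  admissible vertex outside the component of this new root.
\<close>

lemma parent_maps_insert_iff:
  assumes "u \<notin> V"
  shows "q(u := y) \<in> parent_maps (insert u V) C \<and> exits_into (insert u V) (q(u := y)) Q u \<and>
           q u = undefined \<longleftrightarrow>
         y \<in> C u \<and> q \<in> parent_maps V C \<and> exits_into V q (Q - {u}) y"
proof -
  let ?p = "q(u := y)"
  have agree: "exits_into V ?p R x = exits_into V q R x" for R x
    by (rule exits_into_cong) (use assms in auto)
  have PiE: "?p \<in> Pi\<^sub>E (insert u V) C \<and> q u = undefined \<longleftrightarrow> y \<in> C u \<and> q \<in> Pi\<^sub>E V C"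
    using assms by (auto simp: PiE_iff extensional_def split: if_splits)
  have root: "exits_into (insert u V) ?p R u \<longleftrightarrow> exits_into V q (R - {u}) y" for R
    using exits_into_insert_self_iff[OF assms, of ?p R] by (simp add: agree)
  have down: "exits_into V q UNIV v" if "exits_into (insert u V) ?p UNIV v" for v
    using exits_into_insert_cases[OF that assms] by (auto simp: agree intro: exits_into_mono)
  have up: "exits_into (insert u V) ?p UNIV v"
    if v: "exits_into V q UNIV v" and u: "exits_into (insert u V) ?p UNIV u" for v
  proof -
    have "exits_into V ?p UNIV v" using v by (simp add: agree)
    then show ?thesis
    proof (induction rule: exits_into.induct)
      case (outside v)
      then show ?case using u by (metis UNIV_I exits_into.outside insertE)
    qed (auto intro: exits_into.inside)
  qed
  show ?thesis
  proof (intro iffI conjI; elim conjE)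
    assume p: "?p \<in> parent_maps (insert u V) C" "exits_into (insert u V) ?p Q u" "q u = undefined"
    show "y \<in> C u" using p PiE by (auto simp: parent_maps_def)
    show "q \<in> parent_maps V C" using p PiE down by (auto simp: parent_maps_def)
    show "exits_into V q (Q - {u}) y" using p root by auto
  next
    assume q: "y \<in> C u" "q \<in> parent_maps V C" "exits_into V q (Q - {u}) y"
    show u: "exits_into (insert u V) ?p Q u" using q root by auto
    have "exits_into (insert u V) ?p UNIV u" using exits_into_mono[OF u] by auto
    then show "?p \<in> parent_maps (insert u V) C"
      using q PiE up by (auto simp: parent_maps_def)
    show "q u = undefined" using q PiE by (auto simp: parent_maps_def)
  qed
qed

lemma card_parent_maps_insert:
  assumes "finite V" "\<And>v. v \<in> insert u V \<Longrightarrow> finite (C v)" "u \<notin> V"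
  shows "card {p \<in> parent_maps (insert u V) C. exits_into (insert u V) p Q u} =
         (\<Sum>y\<in>C u. card {q \<in> parent_maps V C. exits_into V q (Q - {u}) y})"
proof -
  let ?S = "Sigma (C u) (\<lambda>y. {q \<in> parent_maps V C. exits_into V q (Q - {u}) y})"
  have "bij_betw (\<lambda>(y, q). q(u := y)) ?S
      {p \<in> parent_maps (insert u V) C. exits_into (insert u V) p Q u}"
  proof (rule bij_betw_byWitness[where f' = "\<lambda>p. (p u, p(u := undefined))"])
    show "(\<lambda>(y, q). q(u := y)) ` ?S \<subseteq>
        {p \<in> parent_maps (insert u V) C. exits_into (insert u V) p Q u}"
      using parent_maps_insert_iff[OF assms(3)] by auto
    show "(\<lambda>p. (p u, p(u := undefined))) `
        {p \<in> parent_maps (insert u V) C. exits_into (insert u V) p Q u} \<subseteq> ?S"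
    proof clarsimp
      fix p assume "p \<in> parent_maps (insert u V) C" "exits_into (insert u V) p Q u"
      then show "p u \<in> C u \<and> p(u := undefined) \<in> parent_maps V C \<and>
          exits_into V (p(u := undefined)) (Q - {u}) (p u)"
        using parent_maps_insert_iff[OF assms(3), of "p(u := undefined)" "p u" C Q] by simp
    qed
  qed (use assms(3) in \<open>auto simp: parent_maps_def PiE_iff extensional_def fun_eq_iff\<close>)
  then show ?thesis
    using finite_parent_maps[OF assms(1), of C] assms(2)
    by (subst bij_betw_same_card[symmetric]) (auto simp: card_SigmaI)
qed

text \<open>
  Both counts go by deleting the parent of one vertex \<open>u\<close>, which leads to the smaller vertex set
  \<open>V - {u}\<close>. Each of them uses both formulas there, so that they are proved together. What makes
  the induction work is that the sets \<open>C v\<close>, and with them the numbers \<open>d v = card (C v)\<close>, do not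
  change: \<open>u\<close> remains an admissible parent, now as a root. Write \<open>N\<close> for the number of forests on
  \<open>V - {u}\<close>.

  For the forests in which the path of \<open>u\<close> ends in \<open>Q\<close>, the parent of \<open>u\<close> is one of \<open>a\<close> roots in \<open>Q\<close>, with
  \<open>N\<close> forests each, or a vertex \<open>y\<close> of \<open>V - {u}\<close> whose path ends in \<open>Q\<close>, and the sum over \<open>y\<close> of these
  counts cancels the sum in the formula for \<open>N\<close>.

  For all forests on \<open>V\<close>, the parent of \<open>u\<close> is any of the \<open>d u - 1\<close> admissible vertices \<open>y \<noteq> u\<close>; from the
  \<open>N\<close> forests those have to be subtracted in which the path of \<open>y \<in> V\<close> ends in the new root \<open>u\<close>. This
  is the second count for \<open>Q = {u}\<close>, with \<open>a = 1\<close>.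
\<close>

lemma parent_maps_counts:
  assumes "finite V" "\<And>v. v \<in> V \<Longrightarrow> finite (C v) \<and> V \<subseteq> C v"
  shows "int (card (parent_maps V C)) =
           (\<Prod>v\<in>V. int (card (C v))) - (\<Sum>v\<in>V. \<Prod>w\<in>V - {v}. int (card (C w))) \<and>
         (\<forall>u\<in>V. \<forall>Q a. (\<forall>v\<in>V. card (C v \<inter> Q - V) = a) \<longrightarrow>
           int (card {p \<in> parent_maps V C. exits_into V p Q u}) =
             int a * (\<Prod>v\<in>V - {u}. int (card (C v))))"
  using assms
proof (induction V rule: finite_psubset_induct)
  case (psubset V)
  define d where "d v = int (card (C v))" for v
  define N where "N W = int (card (parent_maps W C))" for W
  define E where "E W Q y = int (card {p \<in> parent_maps W C. exits_into W p Q y})" for W Q y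
  have split: "E V Q u = (\<Sum>y\<in>V - {u}. E (V - {u}) (Q - {u}) y) +
      int (card (C u \<inter> Q - V)) * N (V - {u})" if u: "u \<in> V" for u Q
  proof -
    have fin: "finite (C u)" and sub: "V - {u} \<subseteq> C u" using psubset.prems[OF u] by auto
    have "E V Q u = (\<Sum>y\<in>C u. E (V - {u}) (Q - {u}) y)"
      using card_parent_maps_insert[of "V - {u}" u C Q] psubset.hyps psubset.prems
      by (simp add: insert_absorb[OF u] E_def)
    also have "\<dots> = (\<Sum>y\<in>V - {u}. E (V - {u}) (Q - {u}) y) +
        (\<Sum>y\<in>C u - (V - {u}). E (V - {u}) (Q - {u}) y)"
      using sum.subset_diff[OF sub fin] by (simp add: add.commute)
    also have "(\<Sum>y\<in>C u - (V - {u}). E (V - {u}) (Q - {u}) y) =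
        (\<Sum>y\<in>C u - (V - {u}). if y \<in> Q - {u} then N (V - {u}) else 0)"
      by (rule sum.cong) (auto simp: E_def N_def exits_into_outside_iff)
    also have "\<dots> = (\<Sum>y\<in>C u \<inter> Q - V. N (V - {u}))"
      using u fin by (intro sum.mono_neutral_cong_right) auto
    finally show ?thesis by simp
  qed
  have IH: "N (V - {u}) = (\<Prod>v\<in>V - {u}. d v) - (\<Sum>v\<in>V - {u}. \<Prod>w\<in>V - {u} - {v}. d w)"
    "\<And>y Q a. y \<in> V - {u} \<Longrightarrow> (\<And>v. v \<in> V - {u} \<Longrightarrow> card (C v \<inter> Q - (V - {u})) = a) \<Longrightarrow>
        E (V - {u}) Q y = int a * (\<Prod>v\<in>V - {u} - {y}. d v)"
    if u: "u \<in> V" for u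
    using psubset.IH[of "V - {u}"] psubset.prems u unfolding N_def E_def d_def by blast+
  have ending: "E V Q u = int a * (\<Prod>v\<in>V - {u}. d v)"
    if u: "u \<in> V" and a: "\<And>v. v \<in> V \<Longrightarrow> card (C v \<inter> Q - V) = a" for u Q a
  proof -
    have "C v \<inter> (Q - {u}) - (V - {u}) = C v \<inter> Q - V" for v using u by auto
    then have "E (V - {u}) (Q - {u}) y = int a * (\<Prod>v\<in>V - {u} - {y}. d v)" if "y \<in> V - {u}" for y
      using that IH(2)[OF u, of y "Q - {u}" a] a by simp
    then have "E V Q u = (\<Sum>y\<in>V - {u}. int a * (\<Prod>v\<in>V - {u} - {y}. d v)) + int a * N (V - {u})"
      using split[OF u, of Q] a[OF u] by simp
    then show ?thesis by (simp add: IH(1)[OF u] sum_distrib_left[symmetric] algebra_simps)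
  qed
  have total: "N V = (\<Prod>v\<in>V. d v) - (\<Sum>v\<in>V. \<Prod>w\<in>V - {v}. d w)"
  proof (cases "V = {}")
    case True
    then show ?thesis by (simp add: N_def parent_maps_def)
  next
    case False
    then obtain u where u: "u \<in> V" by auto
    let ?P = "\<lambda>y. \<Prod>v\<in>V - {u} - {y}. d v"
    have fin: "finite (C u)" "V \<subseteq> C u" "finite V" using psubset.prems[OF u] psubset.hyps by auto
    have "{p \<in> parent_maps V C. exits_into V p UNIV u} = parent_maps V C"
      using u by (auto simp: parent_maps_def)
    then have "N V = E V UNIV u" by (simp add: N_def E_def)
    also have "\<dots> = (\<Sum>y\<in>V - {u}. E (V - {u}) (UNIV - {u}) y) + int (card (C u - V)) * N (V - {u})"
      using split[OF u, of UNIV] by simp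
    also have "(\<Sum>y\<in>V - {u}. E (V - {u}) (UNIV - {u}) y) = (\<Sum>y\<in>V - {u}. N (V - {u}) - ?P y)"
    proof (rule sum.cong[OF refl])
      fix y assume y: "y \<in> V - {u}"
      have one: "card (C v \<inter> {u} - (V - {u})) = 1" if "v \<in> V - {u}" for v
      proof -
        have "C v \<inter> {u} - (V - {u}) = {u}" using psubset.prems[of v] that u by auto
        then show ?thesis by simp
      qed
      have "{p \<in> parent_maps (V - {u}) C. exits_into (V - {u}) p (UNIV - {u}) y} =
          parent_maps (V - {u}) C - {p \<in> parent_maps (V - {u}) C. exits_into (V - {u}) p {u} y}"
        using y exits_into_Compl[of "V - {u}" _ y "{u}"] unfolding Compl_eq_Diff_UNIV
        by (auto simp: parent_maps_def)
      moreover have "finite (parent_maps (V - {u}) C)"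
        using psubset.prems fin by (intro finite_parent_maps) auto
      ultimately have "E (V - {u}) (UNIV - {u}) y = N (V - {u}) - E (V - {u}) {u} y"
        by (simp add: E_def N_def card_Diff_subset of_nat_diff card_mono)
      then show "E (V - {u}) (UNIV - {u}) y = N (V - {u}) - ?P y"
        using IH(2)[OF u y, of "{u}" 1] one by simp
    qed
    also have "\<dots> = (int (card V) - 1) * N (V - {u}) - (\<Sum>y\<in>V - {u}. ?P y)"
      using u fin by (simp add: sum_subtractf card_Suc_Diff1[symmetric] del: card_Diff_insert)
    finally have "N V = (d u - 1) * N (V - {u}) - (\<Sum>y\<in>V - {u}. ?P y)"
      using fin by (simp add: d_def card_Diff_subset of_nat_diff card_mono algebra_simps)
    also have "\<dots> = d u * (\<Prod>v\<in>V - {u}. d v) - ((\<Prod>v\<in>V - {u}. d v) + (\<Sum>y\<in>V - {u}. d u * ?P y))"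
      by (simp add: IH(1)[OF u] sum_distrib_left[symmetric] algebra_simps)
    also have "(\<Sum>y\<in>V - {u}. d u * ?P y) = (\<Sum>y\<in>V - {u}. \<Prod>v\<in>V - {y}. d v)"
    proof (rule sum.cong[OF refl])
      fix y assume "y \<in> V - {u}"
      then have "u \<in> V - {y}" using u by auto
      moreover have "V - {u} - {y} = V - {y} - {u}" by auto
      ultimately show "d u * ?P y = (\<Prod>v\<in>V - {y}. d v)"
        using prod.remove[of "V - {y}" u d] fin(3) by simp
    qed
    finally show ?thesis
      using prod.remove[OF fin(3) u, of d]
        sum.remove[OF fin(3) u, of "\<lambda>v. \<Prod>w\<in>V - {v}. d w"] by simp
  qed
  from total ending show ?case unfolding N_def E_def d_def by blast
qed

lemma card_parent_maps:
  assumes "finite V" "\<And>v. v \<in> V \<Longrightarrow> finite (C v) \<and> V \<subseteq> C v"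
  shows "int (card (parent_maps V C)) =
           (\<Prod>v\<in>V. int (card (C v))) - (\<Sum>v\<in>V. \<Prod>w\<in>V - {v}. int (card (C w)))"
  by (rule parent_maps_counts[of V C, OF assms, THEN conjunct1])

lemma card_parent_maps_exits_into:
  assumes "finite V" "\<And>v. v \<in> V \<Longrightarrow> finite (C v) \<and> V \<subseteq> C v"
    and "u \<in> V" "\<And>v. v \<in> V \<Longrightarrow> card (C v \<inter> Q - V) = a"
  shows "int (card {p \<in> parent_maps V C. exits_into V p Q u}) =
           int a * (\<Prod>v\<in>V - {u}. int (card (C v)))"
  using parent_maps_counts[of V C, OF assms(1,2), THEN conjunct2] assms(3,4) by simp

text \<open>
  Vertices whose only admissible parent is the root \<open>r\<close> may as well be roots themselves.
\<close>

lemma card_parent_maps_star: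
  assumes "finite V" "finite B" "V \<inter> B = {}" "r \<notin> V \<union> B"
    and "\<And>b. b \<in> B \<Longrightarrow> C b = {r}" "\<And>v. v \<in> V \<Longrightarrow> finite (C v)"
  shows "card (parent_maps (B \<union> V) C) = card (parent_maps V C)"
  using assms(2-5)
proof (induction B)
  case (insert b B)
  let ?V = "B \<union> V"
  have "parent_maps (insert b ?V) C =
      {p \<in> parent_maps (insert b ?V) C. exits_into (insert b ?V) p UNIV b}"
    by (auto simp: parent_maps_def)
  also have "card \<dots> = card {q \<in> parent_maps ?V C. exits_into ?V q (UNIV - {b}) r}"
  proof -
    have "finite (C v)" if "v \<in> insert b ?V" for v
      using that insert.prems assms(6) by (metis Un_iff finite.simps insertI1 insert_iff)
    then show ?thesis
      using card_parent_maps_insert[of ?V b C UNIV] insert.hyps insert.prems(1,3) assms(1) by simp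
  qed
  also have "{q \<in> parent_maps ?V C. exits_into ?V q (UNIV - {b}) r} = parent_maps ?V C"
    using insert.prems by (auto simp: exits_into_outside_iff)
  finally show ?case using insert by auto
qed simp

section \<open>A vanishing sum over all subsets\<close>

text \<open>
  Collect the terms by the set \<open>B\<close> for which \<open>\<Prod>v\<in>M - B. d v\<close> occurs. It comes from \<open>A = B\<close> in the first
  product, with coefficient \<open>card (B \<inter> G)\<close>, and from \<open>A = B - {w}\<close> with \<open>w \<in> B\<close> in the other two sums. If
  \<open>b = card B\<close> and \<open>g = card (B \<inter> G)\<close>, the latter contribute \<open>- g * (b - 1)\<close> and \<open>g * (b - 2)\<close>. The total
  is \<open>g - g * (b - 1) + g * (b - 2) = 0\<close>, whatever the numbers \<open>d v\<close> are.
\<close>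

lemma sum_over_subsets_vanishes:
  fixes d :: "'a \<Rightarrow> int"
  assumes "finite M" "G \<subseteq> M"
  shows "(\<Sum>A\<in>Pow M. int (card (A \<inter> G)) *
             ((\<Prod>v\<in>M - A. d v) - (\<Sum>w\<in>M - A. \<Prod>v\<in>M - A - {w}. d v)) +
           (int (card A) - 1) * (\<Sum>w\<in>G - A. \<Prod>v\<in>M - A - {w}. d v)) = 0"
proof -
  define f where "f A w = ((if w \<in> G then int (card A) - 1 else 0) - int (card (A \<inter> G))) *
      (\<Prod>v\<in>M - A - {w}. d v)" for A w
  \<comment> \<open>The substitution \<open>B = insert w A\<close>.\<close>
  have "(\<Sum>A\<in>Pow M. \<Sum>w\<in>M - A. f A w) = (\<Sum>B\<in>Pow M. \<Sum>w\<in>B. f (B - {w}) w)"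
  proof -
    have fin: "finite (Pow M)" "\<forall>A\<in>Pow M. finite (M - A)" "\<forall>A\<in>Pow M. finite A"
      using assms(1) by (auto intro: finite_subset)
    show ?thesis
      unfolding sum.Sigma[OF fin(1,2)] sum.Sigma[OF fin(1,3)]
      by (rule sum.reindex_bij_witness[where i = "\<lambda>(B, w). (B - {w}, w)"
            and j = "\<lambda>(A, w). (insert w A, w)"]) auto
  qed
  also have "\<dots> = (\<Sum>B\<in>Pow M. - int (card (B \<inter> G)) * (\<Prod>v\<in>M - B. d v))"
  proof (rule sum.cong[OF refl])
    fix B assume "B \<in> Pow M"
    then have B: "finite B" "B \<subseteq> M" using assms(1) by (auto intro: finite_subset)
    have "f (B - {w}) w = ((if w \<in> G then int (card B) - 1 else 0) - int (card (B \<inter> G))) *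
        (\<Prod>v\<in>M - B. d v)" if w: "w \<in> B" for w
    proof -
      have "M - (B - {w}) - {w} = M - B" using w B by auto
      moreover have "int (card (B - {w})) = int (card B) - 1"
        using card_Suc_Diff1[OF B(1) w] by linarith
      moreover have "int (card ((B - {w}) \<inter> G)) = int (card (B \<inter> G)) - (if w \<in> G then 1 else 0)"
      proof (cases "w \<in> G")
        case True
        then have "(B - {w}) \<inter> G = B \<inter> G - {w}" "w \<in> B \<inter> G" using w by auto
        then show ?thesis using card_Suc_Diff1[of "B \<inter> G" w] B(1) True by simp
      next
        case False
        then have "(B - {w}) \<inter> G = B \<inter> G" by auto
        then show ?thesis using False by simp
      qed
      ultimately show ?thesis by (simp add: f_def)
    qed
    then have "(\<Sum>w\<in>B. f (B - {w}) w) =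
        (\<Sum>w\<in>B. (if w \<in> G then int (card B) - 1 else 0) - int (card (B \<inter> G))) * (\<Prod>v\<in>M - B. d v)"
      by (simp add: sum_distrib_right)
    also have "(\<Sum>w\<in>B. (if w \<in> G then int (card B) - 1 else 0) - int (card (B \<inter> G))) =
        - int (card (B \<inter> G))"
      using B(1) by (simp add: sum_subtractf sum.inter_restrict[symmetric] algebra_simps)
    finally show "(\<Sum>w\<in>B. f (B - {w}) w) = - int (card (B \<inter> G)) * (\<Prod>v\<in>M - B. d v)" .
  qed
  finally have cancel: "(\<Sum>A\<in>Pow M. \<Sum>w\<in>M - A. f A w) =
      - (\<Sum>A\<in>Pow M. int (card (A \<inter> G)) * (\<Prod>v\<in>M - A. d v))"
    by (simp add: sum_negf)
  have "int (card (A \<inter> G)) * ((\<Prod>v\<in>M - A. d v) - (\<Sum>w\<in>M - A. \<Prod>v\<in>M - A - {w}. d v)) +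
           (int (card A) - 1) * (\<Sum>w\<in>G - A. \<Prod>v\<in>M - A - {w}. d v) =
        int (card (A \<inter> G)) * (\<Prod>v\<in>M - A. d v) + (\<Sum>w\<in>M - A. f A w)" for A
  proof -
    have "(M - A) \<inter> G = G - A" using assms(2) by auto
    then have "(\<Sum>w\<in>M - A. if w \<in> G then g w else 0) = (\<Sum>w\<in>G - A. g w)" for g :: "'a \<Rightarrow> int"
      using assms(1) sum.inter_restrict[of "M - A" g G] by simp
    moreover have "f A w = (if w \<in> G then (int (card A) - 1) * (\<Prod>v\<in>M - A - {w}. d v) else 0) -
        int (card (A \<inter> G)) * (\<Prod>v\<in>M - A - {w}. d v)" for w
      by (simp add: f_def algebra_simps)
    ultimately have "(\<Sum>w\<in>M - A. f A w) =
        (int (card A) - 1) * (\<Sum>w\<in>G - A. \<Prod>v\<in>M - A - {w}. d v) -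
        int (card (A \<inter> G)) * (\<Sum>w\<in>M - A. \<Prod>v\<in>M - A - {w}. d v)"
      by (simp add: sum_subtractf sum_distrib_left)
    then show ?thesis by (simp only: right_diff_distrib)
  qed
  then show ?thesis by (simp only: sum.distrib cancel)
qed

section \<open>Trees as parent maps\<close>

definition tree_of :: "'a set \<Rightarrow> 'a \<Rightarrow> ('a \<Rightarrow> 'a) \<Rightarrow> 'a pair_pre_digraph" where
  "tree_of X r p = \<lparr>pverts = X,
     parcs = {(x, y). x \<in> X - {r} \<and> p x = y \<or> y \<in> X - {r} \<and> p y = x}\<rparr>"

lemma tree_of_simps [simp]:
  "pverts (tree_of X r p) = X"
  "(x, y) \<in> parcs (tree_of X r p) \<longleftrightarrow> x \<in> X - {r} \<and> p x = y \<or> y \<in> X - {r} \<and> p y = x"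
  by (auto simp: tree_of_def)

lemma connected_pair_sym_iff:
  assumes "pair_sym_digraph T"
  shows "connected (with_proj T) \<longleftrightarrow> strongly_connected (with_proj T)"
proof -
  interpret pair_sym_digraph T by fact
  have "parcs (mk_symmetric (with_proj T)) = parcs T"
    by (auto simp: mk_symmetric_def dest: arcs_symmetric)
  then have "mk_symmetric (with_proj T) = T"
    by (intro pair_pre_digraph.equality) (auto simp: mk_symmetric_def)
  then show ?thesis by (simp add: connected_def)
qed

lemma pcas_nth_Suc: "pcas u c v \<Longrightarrow> Suc i < length c \<Longrightarrow> fst (c ! Suc i) = snd (c ! i)"
proof (induction u c v arbitrary: i rule: pcas.induct)
  case (2 u e es v)
  then show ?case by (cases es; cases i) auto
qed simp

lemma pcas_ends: "pcas u c v \<Longrightarrow> c \<noteq> [] \<Longrightarrow> fst (hd c) = u \<and> snd (last c) = v"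
  by (induction u c v rule: pcas.induct) (auto split: if_splits)

lemma pawalk_verts_conv: "pcas u c v \<Longrightarrow> pawalk_verts u c = u # map snd c"
  by (induction u c v rule: pcas.induct) auto

text \<open>
  The length bound is what makes the predecessor and the successor of a vertex of the cycle
  different; the cycle \<open>u, v, u\<close> along a single edge does not have this property.
\<close>

lemma long_cycle_two_neighbours:
  assumes cyc: "pre_digraph.cycle (with_proj T) c" and len: "length c \<ge> 3"
  obtains Z where "finite Z" "Z \<noteq> {}"
    "\<And>z. z \<in> Z \<Longrightarrow> \<exists>x\<in>Z. \<exists>y\<in>Z. x \<noteq> y \<and> (x, z) \<in> parcs T \<and> (z, y) \<in> parcs T"
proof -
  interpret pair_pre_digraph T .
  obtain u where u: "pcas u c u" "set c \<subseteq> parcs T" "distinct (map snd c)"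
    using cyc unfolding cycle_def awalk_def by (auto simp: pawalk_verts_conv)
  show thesis
  proof
    show "finite (snd ` set c)" "snd ` set c \<noteq> {}" using len by auto
    fix z assume "z \<in> snd ` set c"
    then obtain i where i: "i < length c" "z = snd (c ! i)" by (auto simp: in_set_conv_nth)
    \<comment> \<open>The positions before and after \<open>i\<close>, cyclically.\<close>
    define j k where "j = (if i = 0 then length c - 1 else i - 1)"
      and "k = (if Suc i = length c then 0 else Suc i)"
    have jk: "j < length c" "k < length c" "j \<noteq> k" using i len by (auto simp: j_def k_def)
    have "c \<noteq> []" using len by auto
    then have wrap: "fst (c ! 0) = snd (c ! (length c - 1))"
      using pcas_ends[OF u(1)] by (auto simp: hd_conv_nth last_conv_nth)
    have "fst (c ! i) = snd (c ! j)"
      using pcas_nth_Suc[OF u(1), of "i - 1"] wrap i by (auto simp: j_def)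
    moreover have "fst (c ! k) = z"
    proof (cases "Suc i = length c")
      case True
      then have "length c - 1 = i" by simp
      with True wrap i show ?thesis by (simp add: k_def)
    next
      case False
      with pcas_nth_Suc[OF u(1), of i] i show ?thesis by (simp add: k_def)
    qed
    moreover have "snd (c ! j) \<noteq> snd (c ! k)"
      using jk u(3) nth_eq_iff_index_eq[of "map snd c" j k] by simp
    moreover have "c ! i \<in> parcs T" "c ! k \<in> parcs T"
      using u(2) i jk by (meson nth_mem subsetD)+
    ultimately show "\<exists>x\<in>snd ` set c. \<exists>y\<in>snd ` set c. x \<noteq> y \<and> (x, z) \<in> parcs T \<and> (z, y) \<in> parcs T"
      using jk i by (intro bexI[of _ "snd (c ! j)"] bexI[of _ "snd (c ! k)"])
        (auto simp: prod_eq_iff[symmetric] simp del: prod_eq_iff, (metis prod.collapse)+)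
  qed
qed

text \<open>
  All vertices are connected to \<open>r\<close> along their ancestors. On a long cycle \<open>Z\<close>, each vertex has two
  neighbours, of which at most one is its parent, so that it has a child in \<open>Z\<close>. Hence \<open>Z \<subseteq> p ` Z\<close>, and by
  finiteness \<open>p\<close> permutes \<open>Z\<close>: no path of ancestors leads from \<open>Z\<close> to the root.
\<close>

lemma undirected_tree_tree_of:
  assumes "finite X" "r \<in> X" and p: "p \<in> parent_maps (X - {r}) (\<lambda>_. X)"
  shows "undirected_tree (tree_of X r p)"
proof -
  let ?T = "tree_of X r p"
  have pX: "p v \<in> X" and exits: "exits_into (X - {r}) p UNIV v" if "v \<in> X - {r}" for v
    using p that by (auto simp: parent_maps_def)
  have no_loop: "p v \<noteq> v" if "v \<in> X - {r}" for v
    using not_exits_into_if_closed[of "{v}" "X - {r}" p v UNIV] exits[OF that] that by auto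
  have "parcs ?T \<subseteq> X \<times> X" using pX by auto
  then have fin: "finite (parcs ?T)" using finite_subset assms(1) by blast
  interpret T: pair_graph ?T
    using pX no_loop fin assms(1) by unfold_locales (auto simp: symmetric_def sym_def)
  have to_root: "v \<rightarrow>\<^sup>*\<^bsub>with_proj ?T\<^esub> r" if "v \<in> X" for v
  proof (cases "v = r")
    case False
    have "exits_into (X - {r}) p UNIV x \<Longrightarrow> x \<in> X \<Longrightarrow> x \<rightarrow>\<^sup>*\<^bsub>with_proj ?T\<^esub> r" for x
    proof (induction rule: exits_into.induct)
      case (outside x)
      then show ?case using assms(2) by auto
    next
      case (inside x)
      then have "(x, p x) \<in> parcs ?T" "p x \<rightarrow>\<^sup>*\<^bsub>with_proj ?T\<^esub> r" using pX by auto
      then show ?case by (rule T.adj_reachable_trans)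
    qed
    then show ?thesis using exits[of v] that False by auto
  qed (use assms(2) in auto)
  have "u \<rightarrow>\<^sup>*\<^bsub>with_proj ?T\<^esub> v" if "u \<in> X" "v \<in> X" for u v
    using to_root[OF that(1)] symmetric_reachable[OF T.pair_sym_arcs to_root[OF that(2)]]
    by (rule T.reachable_trans)
  then have "connected (with_proj ?T)"
    using assms(2) connected_pair_sym_iff[of ?T] T.pair_sym_digraph_axioms
    by (auto simp: strongly_connected_def)
  moreover have False if cyc: "pre_digraph.cycle (with_proj ?T) c" "length c \<ge> 3" for c
  proof -
    obtain Z where Z: "finite Z" "Z \<noteq> {}"
      and nbrs: "\<And>z. z \<in> Z \<Longrightarrow> \<exists>x\<in>Z. \<exists>y\<in>Z. x \<noteq> y \<and> (x, z) \<in> parcs ?T \<and> (z, y) \<in> parcs ?T"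
      using long_cycle_two_neighbours[OF cyc] by blast
    let ?U = "Z \<inter> (X - {r})"
    have sub: "Z \<subseteq> p ` ?U"
    proof
      fix z assume "z \<in> Z"
      from nbrs[OF this] show "z \<in> p ` ?U" by auto
    qed
    have "card (p ` ?U) \<le> card ?U" using Z by (intro card_image_le) auto
    moreover have "card ?U \<le> card Z" using Z by (intro card_mono) auto
    moreover have "card Z \<le> card (p ` ?U)" using Z sub by (intro card_mono) auto
    ultimately have le: "card Z \<le> card ?U" "card (p ` ?U) \<le> card Z" by linarith+
    have U: "?U = Z" by (rule card_seteq[OF Z(1) Int_lower1 le(1)])
    have "Z = p ` ?U" by (rule card_seteq[OF _ sub le(2)]) (use Z in auto)
    then have closed: "p ` Z \<subseteq> Z" unfolding U by simp
    obtain z where "z \<in> Z" using Z by auto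
    moreover have "Z \<subseteq> X - {r}" using U by auto
    ultimately show False
      using not_exits_into_if_closed[OF _ closed] exits by blast
  qed
  ultimately show ?thesis
    using T.pair_graph by (auto simp: undirected_tree_def)
qed

text \<open>
  The tree determines the parents, by induction starting at the root: if \<open>v\<close> had different parents
  under \<open>p\<close> and \<open>q\<close>, then the edge between \<open>v\<close> and \<open>p v\<close> would make \<open>v\<close> the parent of \<open>p v\<close> under \<open>q\<close>, and
  therefore also under \<open>p\<close>, a cycle of length two.
\<close>

lemma tree_of_inj:
  "inj_on (tree_of X r) (parent_maps (X - {r}) (\<lambda>_. X))"
proof (rule inj_onI)
  fix p q assume p: "p \<in> parent_maps (X - {r}) (\<lambda>_. X)" and q: "q \<in> parent_maps (X - {r}) (\<lambda>_. X)"
    and eq: "tree_of X r p = tree_of X r q"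
  have arcs: "x \<in> X - {r} \<and> p x = y \<or> y \<in> X - {r} \<and> p y = x \<longleftrightarrow>
      x \<in> X - {r} \<and> q x = y \<or> y \<in> X - {r} \<and> q y = x" for x y
    using eq tree_of_simps(2) by metis
  have "exits_into (X - {r}) p UNIV v \<Longrightarrow> v \<in> X - {r} \<longrightarrow> p v = q v" for v
  proof (induction rule: exits_into.induct)
    case (inside v)
    show ?case
    proof (rule ccontr)
      assume "\<not> ?thesis"
      then have "p v \<in> X - {r}" "q (p v) = v" using arcs[of v "p v"] inside.hyps by auto
      with inside.IH have "p (p v) = v" by simp
      then have "\<not> exits_into (X - {r}) p UNIV v"
        using not_exits_into_if_closed[of "{v, p v}" "X - {r}" p v] inside.hyps \<open>p v \<in> X - {r}\<close> by auto
      then show False using p inside.hyps by (auto simp: parent_maps_def)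
    qed
  qed blast
  then show "p = q"
    using p q by (intro PiE_ext[of p "X - {r}" "\<lambda>_. X" q]) (auto simp: parent_maps_def)
qed

text \<open>
  As parent of \<open>v\<close> one can take any neighbour that is closer to \<open>r\<close>. The resulting tree \<open>S\<close> spans \<open>T\<close>,
  and an edge of \<open>T\<close> outside \<open>S\<close> would close a path of \<open>S\<close> to a cycle of \<open>T\<close>.
\<close>

lemma undirected_tree_parent_map:
  assumes T: "undirected_tree T" and r: "r \<in> pverts T"
  obtains p where "p \<in> parent_maps (pverts T - {r}) (\<lambda>_. pverts T)" "tree_of (pverts T) r p = T"
proof -
  interpret T: pair_graph T using T by (simp add: undirected_tree_def)
  have "strongly_connected (with_proj T)"
    using T connected_pair_sym_iff[of T] T.pair_sym_digraph_axioms by (auto simp: undirected_tree_def)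
  then have reach: "\<exists>c. T.awalk v c r" if "v \<in> pverts T" for v
    using that r by (auto simp: strongly_connected_def T.reachable_awalk)
  define dist_r where "dist_r v = (LEAST k. \<exists>c. T.awalk v c r \<and> length c = k)" for v
  have closer: "\<exists>w. (v, w) \<in> parcs T \<and> dist_r w < dist_r v" if v: "v \<in> pverts T - {r}" for v
  proof -
    obtain c where c: "T.awalk v c r" "length c = dist_r v"
      using reach[of v] v LeastI_ex[of "\<lambda>k. \<exists>c. T.awalk v c r \<and> length c = k"]
      unfolding dist_r_def by blast
    then obtain e c' where c': "c = e # c'"
      using v by (cases c) (auto simp: T.awalk_Nil_iff)
    then have e: "e \<in> parcs T" "fst e = v" "T.awalk (snd e) c' r"
      using c by (auto simp: T.awalk_Cons_iff)
    then have "dist_r (snd e) \<le> length c'"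
      unfolding dist_r_def by (intro Least_le) auto
    then show ?thesis using e c c' by (intro exI[of _ "snd e"]) auto
  qed
  define p where "p = (\<lambda>v\<in>pverts T - {r}. SOME w. (v, w) \<in> parcs T \<and> dist_r w < dist_r v)"
  have p: "(v, p v) \<in> parcs T" "dist_r (p v) < dist_r v" if "v \<in> pverts T - {r}" for v
    using someI_ex[OF closer[OF that]] that by (auto simp: p_def)
  have "exits_into (pverts T - {r}) p UNIV v" for v
  proof (induction "dist_r v" arbitrary: v rule: less_induct)
    case less
    then show ?case using p(2)[of v] by (cases "v \<in> pverts T - {r}") (auto intro: exits_into.intros)
  qed
  then have pm: "p \<in> parent_maps (pverts T - {r}) (\<lambda>_. pverts T)"
    using p(1) by (auto simp: parent_maps_def p_def dest: T.in_arcsD2)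
  let ?S = "tree_of (pverts T) r p"
  have S: "undirected_tree ?S"
    using undirected_tree_tree_of[OF T.pair_finite_verts r pm] .
  interpret S: pair_graph ?S using S by (simp add: undirected_tree_def)
  have sub: "parcs ?S \<subseteq> parcs T"
  proof (rule subrelI)
    fix a b assume "(a, b) \<in> parcs ?S"
    then show "(a, b) \<in> parcs T" using p(1)[of a] p(1)[of b] T.arcs_symmetric by auto
  qed
  have "(x, y) \<in> parcs ?S" if xy: "(x, y) \<in> parcs T" for x y
  proof (rule ccontr)
    assume not_S: "(x, y) \<notin> parcs ?S"
    have "x \<in> pverts T" "y \<in> pverts T" using xy by (auto dest: T.wellformed')
    moreover have "strongly_connected (with_proj ?S)"
      using S connected_pair_sym_iff[of ?S] S.pair_sym_digraph_axioms by (auto simp: undirected_tree_def)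
    ultimately obtain c where c: "S.apath x c y"
      by (auto simp: strongly_connected_def S.reachable_apath)
    then have c': "pcas x c y" "set c \<subseteq> parcs ?S" "distinct (x # map snd c)"
      by (force simp: S.apath_def S.awalk_def pawalk_verts_conv)+
    have "x \<noteq> y" using xy T.no_loops' by auto
    \<comment> \<open>A path of length one would be the edge itself, which is not in \<open>S\<close>.\<close>
    then have len: "length c \<ge> 2"
    proof -
      have "c \<noteq> []" using \<open>x \<noteq> y\<close> c' by auto
      moreover have "c \<noteq> [e]" for e using c' not_S by (cases e) auto
      ultimately show ?thesis by (cases c rule: remdups_adj.cases) auto
    qed
    let ?c = "c @ [(y, x)]"
    have walk: "pcas x ?c x"
    proof -
      have "pcas a c y \<Longrightarrow> pcas a ?c x" for a by (induction a c y rule: pcas.induct) auto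
      then show ?thesis using c' by blast
    qed
    have "distinct (tl (pawalk_verts x ?c))"
      unfolding pawalk_verts_conv[OF walk] using c'(3) by force
    moreover have "set ?c \<subseteq> parcs T" using c'(2) sub T.arcs_symmetric[OF xy] by auto
    ultimately have "T.cycle ?c"
      using walk \<open>x \<in> pverts T\<close> unfolding T.cycle_def T.awalk_def by blast
    then show False using T len by (auto simp: undirected_tree_def)
  qed
  with sub have "parcs ?S = parcs T" by auto
  then have "?S = T" by (cases T) (simp add: tree_of_def)
  with pm show thesis by (rule that)
qed

lemma sons_of_root:
  assumes "undirected_tree T"
  shows "sons T r r = {v. (r, v) \<in> parcs T}"
proof -
  interpret T: pair_graph T using assms by (simp add: undirected_tree_def)
  have "(r, v) \<in> parcs T" if "T.apath r (c @ [(r, v)]) v" for v c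
    using that by (auto simp: T.apath_def)
  moreover have "T.apath r ([] @ [(r, v)]) v" if "(r, v) \<in> parcs T" for v
    using that T.no_loops'[OF that] by (auto simp: T.apath_simps dest: T.in_arcsD2)
  ultimately show ?thesis unfolding sons_def by blast
qed

lemma undirected_tree_has_neighbour:
  assumes "undirected_tree T" "r \<in> pverts T" "v \<in> pverts T" "v \<noteq> r"
  shows "\<exists>u. (r, u) \<in> parcs T"
proof -
  interpret T: pair_graph T using assms by (simp add: undirected_tree_def)
  have "strongly_connected (with_proj T)"
    using assms connected_pair_sym_iff[of T] T.pair_sym_digraph_axioms by (auto simp: undirected_tree_def)
  then obtain c where "T.awalk r c v"
    using assms by (auto simp: strongly_connected_def T.reachable_awalk)
  moreover from this assms(4) have "c \<noteq> []" by (auto simp: T.awalk_Nil_iff)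
  ultimately obtain e where "e \<in> parcs T" "fst e = r"
    by (cases c) (auto simp: T.awalk_Cons_iff)
  then show ?thesis by (intro exI[of _ "snd e"]) auto
qed

section \<open>Trees with a prescribed star\<close>

text \<open>
  The set \<open>A\<close> prescribes the neighbours of \<open>r\<close> only up to \<open>s\<close>: whether \<open>r\<close> and \<open>s\<close> are adjacent is left
  open, except that \<open>r \<in> F\<close> excludes it.
\<close>

definition trees_with_star :: "'a set \<Rightarrow> 'a set \<Rightarrow> 'a \<Rightarrow> 'a \<Rightarrow> 'a set \<Rightarrow> 'a pair_pre_digraph set" where
  "trees_with_star X F s r A = {T. undirected_tree T \<and> pverts T = X \<and>
     {v. (r, v) \<in> parcs T} - {s} = A - {r} \<and> (\<forall>v\<in>F. (s, v) \<notin> parcs T)}"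

text \<open>
  The admissible parents of \<open>v\<close> when a tree counted by \<open>trees_with_star\<close> is rooted at \<open>r\<close>. The root is
  offered to \<open>A\<close>, where it is forced, and to \<open>s\<close> unless \<open>r \<in> F\<close>; any other vertex with parent \<open>r\<close> would
  enlarge the star. The set offered to \<open>s\<close> contains \<open>s\<close> itself, which acyclicity rules out.
\<close>

definition star_choices :: "'a set \<Rightarrow> 'a set \<Rightarrow> 'a \<Rightarrow> 'a \<Rightarrow> 'a set \<Rightarrow> 'a \<Rightarrow> 'a set" where
  "star_choices X F s r A v =
     (if v = s then X - F else if v \<in> A then {r} else X - {r} - (if v \<in> F then {s} else {}))"

lemma bij_betw_trees_with_star:
  assumes X: "finite X" "s \<in> X" and A: "A \<subseteq> X - {s}" "r \<in> A" and F: "F \<subseteq> X - {s}"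
  shows "bij_betw (tree_of X r) (parent_maps (X - {r}) (star_choices X F s r A))
           (trees_with_star X F s r A)"
proof -
  let ?C = "star_choices X F s r A"
  have r: "r \<in> X" "r \<noteq> s" using A by auto
  have "?C v \<subseteq> X" for v using r by (auto simp: star_choices_def)
  then have sub: "parent_maps (X - {r}) ?C \<subseteq> parent_maps (X - {r}) (\<lambda>_. X)"
    by (fastforce simp: parent_maps_def PiE_iff)
  have "tree_of X r p \<in> trees_with_star X F s r A" if p: "p \<in> parent_maps (X - {r}) ?C" for p
  proof -
    have pC: "p v \<in> ?C v" if "v \<in> X - {r}" for v using p that by (auto simp: parent_maps_def)
    have "undirected_tree (tree_of X r p)"
      using undirected_tree_tree_of[OF X(1) r(1)] p sub by blast
    moreover have "p v = r \<longleftrightarrow> v \<in> A" if "v \<in> X - {r}" "v \<noteq> s" for v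
      using pC[OF that(1)] that by (auto simp: star_choices_def split: if_splits)
    then have "{v. (r, v) \<in> parcs (tree_of X r p)} - {s} = A - {r}"
      using A(1) by auto
    moreover have "p s \<notin> F" using pC[of s] X(2) r by (auto simp: star_choices_def)
    moreover have "p v \<noteq> s" if "v \<in> F" "v \<in> X - {r}" for v
      using pC[OF that(2)] that F r by (auto simp: star_choices_def split: if_splits)
    then have "\<forall>v\<in>F. (s, v) \<notin> parcs (tree_of X r p)"
      using \<open>p s \<notin> F\<close> by auto
    ultimately show ?thesis by (simp add: trees_with_star_def)
  qed
  moreover have "T \<in> tree_of X r ` parent_maps (X - {r}) ?C" if T: "T \<in> trees_with_star X F s r A" for T
  proof -
    obtain p where p: "p \<in> parent_maps (X - {r}) (\<lambda>_. X)" "tree_of X r p = T"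
      using undirected_tree_parent_map[of T r] T r by (auto simp: trees_with_star_def)
    have star: "(r, v) \<in> parcs T \<and> v \<noteq> s \<longleftrightarrow> v \<in> A \<and> v \<noteq> r" for v
      using T by (auto simp: trees_with_star_def)
    have avoid: "(s, v) \<notin> parcs T" if "v \<in> F" for v using T that by (auto simp: trees_with_star_def)
    have "p v \<in> ?C v" if v: "v \<in> X - {r}" for v
    proof -
      have "p v \<in> X" using p v by (auto simp: parent_maps_def)
      moreover have "(v, p v) \<in> parcs T" "(p v, v) \<in> parcs T" using v p(2) by auto
      moreover have "p v = r" if "(r, v) \<in> parcs T" using that p(2)[symmetric] by simp
      ultimately show ?thesis
        using star[of v] avoid[of v] avoid[of "p v"] v
        unfolding star_choices_def by (cases "v = s"; cases "v \<in> A"; cases "v \<in> F") auto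
    qed
    then have "p \<in> parent_maps (X - {r}) ?C"
      using p(1) by (auto simp: parent_maps_def PiE_iff)
    with p(2) show ?thesis by blast
  qed
  ultimately show ?thesis
    using inj_on_subset[OF tree_of_inj sub] by (auto simp: bij_betw_def)
qed

text \<open>
  Root the trees at \<open>r\<close>. The elements of \<open>A - {r}\<close> have the parent \<open>r\<close> and can be regarded as roots, and
  so can \<open>s\<close> once its parent \<open>y\<close> is chosen. What remains is a forest on \<open>M - A\<close> in which a vertex has \<open>d v\<close>
  admissible parents. If \<open>y \<in> A\<close>, this forest is arbitrary, which gives the first summand. If \<open>y \<in> M - A\<close>,
  the path of \<open>y\<close> must not end in \<open>s\<close>, that is, it must end in one of the \<open>card A - 1\<close> elements of
  \<open>A - {r}\<close>, which are admissible parents for all vertices of \<open>M - A\<close>; this gives the second summand.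
\<close>

lemma card_trees_with_star:
  fixes X F A :: "'a set" and s r :: 'a
  assumes X: "finite X" "s \<in> X" and A: "A \<subseteq> X - {s}" "r \<in> A" and F: "F \<subseteq> X - {s}"
  defines "M \<equiv> X - {s}" and "d \<equiv> (\<lambda>v. int (card X) - (if v \<in> F then 2 else 1))"
  shows "int (card (trees_with_star X F s r A)) =
      int (card (A \<inter> (M - F))) *
        ((\<Prod>v\<in>M - A. d v) - (\<Sum>w\<in>M - A. \<Prod>v\<in>M - A - {w}. d v)) +
      (int (card A) - 1) * (\<Sum>w\<in>M - F - A. \<Prod>v\<in>M - A - {w}. d v)"
proof -
  let ?C = "star_choices X F s r A"
  let ?W = "M - A"
  let ?n = "\<lambda>y. int (card {q \<in> parent_maps ?W ?C. exits_into ?W q (UNIV - {s}) y})"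
  have r: "r \<in> X" "r \<noteq> s" using A by auto
  have fin: "finite A" "finite ?W" "finite (?C v)" for v
    using X A finite_subset[OF A(1)] by (auto simp: M_def star_choices_def)
  have "card (trees_with_star X F s r A) = card (parent_maps (X - {r}) ?C)"
    using bij_betw_same_card[OF bij_betw_trees_with_star[OF X A F]] by simp
  also have "\<dots> = card (parent_maps ((A - {r}) \<union> insert s ?W) ?C)"
  proof -
    have "X - {r} = (A - {r}) \<union> insert s ?W" using A X by (auto simp: M_def)
    then show ?thesis by (rule arg_cong)
  qed
  also have "\<dots> = card (parent_maps (insert s ?W) ?C)"
    using A fin by (intro card_parent_maps_star[of _ _ r]) (auto simp: M_def star_choices_def)
  also have "\<dots> = card {p \<in> parent_maps (insert s ?W) ?C. exits_into (insert s ?W) p UNIV s}"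
    by (rule arg_cong[of _ _ card]) (auto simp: parent_maps_def)
  also have "\<dots> = (\<Sum>y\<in>?C s. card {q \<in> parent_maps ?W ?C. exits_into ?W q (UNIV - {s}) y})"
    by (rule card_parent_maps_insert) (use fin in \<open>auto simp: M_def\<close>)
  finally have "int (card (trees_with_star X F s r A)) = (\<Sum>y\<in>?C s. ?n y)"
    by (simp only: of_nat_sum)
  also have "\<dots> = ?n s + ((\<Sum>y\<in>A \<inter> (M - F). ?n y) + (\<Sum>y\<in>M - F - A. ?n y))"
  proof -
    have "?C s = insert s ((A \<inter> (M - F)) \<union> (M - F - A))"
      using X A F by (auto simp: M_def star_choices_def)
    moreover have "finite M" "s \<notin> M" using X by (auto simp: M_def)
    ultimately show ?thesis
      using fin(1) by (simp only:) (subst sum.insert, auto intro!: sum.union_disjoint)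
  qed
  finally have sum: "int (card (trees_with_star X F s r A)) =
      ?n s + ((\<Sum>y\<in>A \<inter> (M - F). ?n y) + (\<Sum>y\<in>M - F - A. ?n y))" .
  have "?n s = 0"
    by (simp add: M_def exits_into_outside_iff)
  moreover have "(\<Sum>y\<in>A \<inter> (M - F). ?n y) =
      int (card (A \<inter> (M - F))) * int (card (parent_maps ?W ?C))"
  proof -
    have "?n y = int (card (parent_maps ?W ?C))" if "y \<in> A \<inter> (M - F)" for y
    proof -
      have "y \<notin> ?W" "y \<noteq> s" using that by (auto simp: M_def)
      then show ?thesis by (simp add: exits_into_outside_iff)
    qed
    then show ?thesis by simp
  qed
  ultimately have count: "int (card (trees_with_star X F s r A)) =
      int (card (A \<inter> (M - F))) * int (card (parent_maps ?W ?C)) + (\<Sum>y\<in>M - F - A. ?n y)"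
    using sum by (simp only: add_0)
  have C: "finite (?C v) \<and> ?W \<subseteq> ?C v" if "v \<in> ?W" for v
  proof
    show "?W \<subseteq> ?C v" using that A(2) by (auto simp: M_def star_choices_def)
  qed (rule fin(3))
  have d: "int (card (?C v)) = d v" if v: "v \<in> ?W" for v
  proof -
    have "?C v = X - (if v \<in> F then {r, s} else {r})"
      using v by (auto simp: M_def star_choices_def)
    moreover have "card X \<ge> card {r, s}" using X r by (intro card_mono) auto
    ultimately show ?thesis
      using X r by (auto simp: d_def card_Diff_subset of_nat_diff)
  qed
  have dW: "(\<Prod>v\<in>?W. int (card (?C v))) = (\<Prod>v\<in>?W. d v)"
    "(\<Prod>v\<in>?W - {w}. int (card (?C v))) = (\<Prod>v\<in>?W - {w}. d v)" for w
    using d by (auto intro: prod.cong)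
  \<comment> \<open>A path that leaves \<open>M - A\<close> elsewhere than in \<open>s\<close> leaves it into \<open>A - {r}\<close>.\<close>
  have star: "card (?C v \<inter> (UNIV - {s}) - ?W) = card A - 1" if v: "v \<in> ?W" for v
  proof -
    have "?C v \<inter> (UNIV - {s}) - ?W = A - {r}"
      using v A by (auto simp: M_def star_choices_def)
    then show ?thesis using A fin by simp
  qed
  have "card A \<ge> 1" using A fin by (auto simp: Suc_le_eq card_gt_0_iff)
  then have "?n y = (int (card A) - 1) * (\<Prod>v\<in>?W - {y}. d v)" if "y \<in> M - F - A" for y
    using card_parent_maps_exits_into[of ?W ?C y "UNIV - {s}" "card A - 1"] fin C star that dW
    by (auto simp: of_nat_diff)
  moreover have "int (card (parent_maps ?W ?C)) =
      (\<Prod>v\<in>?W. d v) - (\<Sum>w\<in>?W. \<Prod>v\<in>?W - {w}. d v)"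
    using card_parent_maps[of ?W ?C] fin C dW by simp
  ultimately show ?thesis
    unfolding count by (simp add: sum_distrib_left)
qed

section \<open>Uprooted trees\<close>

text \<open>
  The set \<open>A\<close> consists of the root and its neighbours other than \<open>1\<close>. In an uprooted tree the root is
  the largest element of \<open>A\<close>. It is not \<open>1\<close>, because for \<open>n \<ge> 2\<close> it has a neighbour, which is smaller.
  Conversely, if the neighbours of \<open>Max A\<close> other than \<open>1\<close> form \<open>A - {Max A}\<close>, then \<open>Max A\<close> is larger than
  all its neighbours, whether \<open>1\<close> is one of them or not.
\<close>

lemma bij_betw_uprooted_trees_avoiding:
  assumes "n \<ge> 2"
  shows "bij_betw (\<lambda>(A, T). (T, Max A))
           (SIGMA A:Pow {2..n} - {{}}. trees_with_star {1..n} (last_labels n l) 1 (Max A) A)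
           (uprooted_trees_avoiding n l)"
proof -
  define star where "star T r = insert r ({v. (r, v) \<in> parcs T} - {1})" for T :: "nat pair_pre_digraph" and r
  let ?S = "SIGMA A:Pow {2..n} - {{}}. trees_with_star {1..n} (last_labels n l) 1 (Max A) A"
  have Max_in: "Max A \<in> A" if "A \<in> Pow {2..n} - {{}}" for A
    using that by (intro Max_in) (auto intro: finite_subset)
  then have star_of: "star T (Max A) = A"
    if "(A, T) \<in> ?S" for A T
    using that by (simp add: star_def trees_with_star_def insert_absorb)
  have uprooted: "(T, r) \<in> uprooted_trees_avoiding n l \<longleftrightarrow> undirected_tree T \<and> pverts T = {1..n} \<and>
      r \<in> {1..n} \<and> (\<forall>v. (r, v) \<in> parcs T \<longrightarrow> v < r) \<and> (\<forall>v\<in>last_labels n l. (1, v) \<notin> parcs T)" for T r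
    by (auto simp: uprooted_trees_avoiding_def uprooted_trees_def rooted_trees_def labeled_trees_def
        adjacent_def sons_of_root)
  have into: "(\<lambda>(A, T). (T, Max A)) ` ?S \<subseteq> uprooted_trees_avoiding n l"
  proof
    fix z assume "z \<in> (\<lambda>(A, T). (T, Max A)) ` ?S"
    then obtain A T where z: "z = (T, Max A)" and A: "A \<in> Pow {2..n} - {{}}"
      and T: "T \<in> trees_with_star {1..n} (last_labels n l) 1 (Max A) A" by auto
    have fin: "finite A" using A by (auto intro: finite_subset)
    have M: "Max A \<in> {2..n}" using A Max_in[of A] by auto
    have "v < Max A" if v: "(Max A, v) \<in> parcs T" for v
    proof (cases "v = 1")
      case False
      with v T have "v \<in> A - {Max A}" by (auto simp: trees_with_star_def)
      with fin show ?thesis using Max_ge[of A v] by (simp add: less_le)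
    qed (use M in auto)
    with T M show "z \<in> uprooted_trees_avoiding n l"
      by (auto simp: z uprooted trees_with_star_def)
  qed
  have star: "star T r \<in> Pow {2..n} - {{}}" "Max (star T r) = r"
      "T \<in> trees_with_star {1..n} (last_labels n l) 1 r (star T r)"
    if U: "(T, r) \<in> uprooted_trees_avoiding n l" for T r
  proof -
    have T: "undirected_tree T" "pverts T = {1..n}" and r: "r \<in> {1..n}"
      and less: "\<And>v. (r, v) \<in> parcs T \<Longrightarrow> v < r" using U uprooted by auto
    interpret T: pair_graph T using T by (simp add: undirected_tree_def)
    have nbr: "v \<in> {1..n}" if "(r, v) \<in> parcs T" for v using T.in_arcsD2[OF that] T by simp
    have "\<exists>v\<in>{1..n}. v \<noteq> r" using assms by (intro bexI[of _ "if r = 1 then 2 else 1"]) auto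
    then obtain v where v: "v \<in> {1..n}" "v \<noteq> r" by auto
    obtain u where u: "(r, u) \<in> parcs T"
      using undirected_tree_has_neighbour[OF T(1), of r v] T(2) r v by auto
    have "r \<ge> 2" using less[OF u] nbr[OF u] by simp
    then have sub: "star T r \<subseteq> {2..n}" unfolding star_def using r nbr by fastforce
    then show "star T r \<in> Pow {2..n} - {{}}" by (auto simp: star_def)
    show "Max (star T r) = r"
      using sub less by (intro Max_eqI) (auto simp: star_def intro: finite_subset less_imp_le)
    have "{v. (r, v) \<in> parcs T} - {1} = star T r - {r}"
      using less by (auto simp: star_def)
    then show "T \<in> trees_with_star {1..n} (last_labels n l) 1 r (star T r)"
      using U by (auto simp: uprooted trees_with_star_def)
  qed
  show ?thesis
  proof (rule bij_betw_byWitness[where f' = "\<lambda>(T, r). (star T r, T)"])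
    show "\<forall>a\<in>?S. (case case a of (A, T) \<Rightarrow> (T, Max A) of (T, r) \<Rightarrow> (star T r, T)) = a"
      using star_of by (simp add: split_beta)
    show "\<forall>a\<in>uprooted_trees_avoiding n l.
        (case case a of (T, r) \<Rightarrow> (star T r, T) of (A, T) \<Rightarrow> (T, Max A)) = a"
      using star(2) by (simp add: split_beta)
    show "(\<lambda>(T, r). (star T r, T)) ` uprooted_trees_avoiding n l \<subseteq> ?S"
      using star by fastforce
  qed (rule into)
qed

theorem theorem2p1:
  fixes n l :: nat
  assumes "n \<ge> 3" and "1 \<le> l" and "l \<le> n - 2"
  shows "card (uprooted_trees_avoiding n l) = (n - 1) ^ (n - l - 2) * (n - 2) ^ l * (n - l - 1)"
proof -
  define X F M where "X = {1..n}" and "F = last_labels n l" and "M = X - {1}"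
  define d where "d v = int (card X) - (if v \<in> F then 2 else 1)" for v
  define P where "P A = int (card (A \<inter> (M - F))) *
      ((\<Prod>v\<in>M - A. d v) - (\<Sum>w\<in>M - A. \<Prod>v\<in>M - A - {w}. d v)) +
      (int (card A) - 1) * (\<Sum>w\<in>M - F - A. \<Prod>v\<in>M - A - {w}. d v)" for A
  have X: "finite X" "1 \<in> X" and F: "F \<subseteq> X - {1}"
    using assms by (auto simp: X_def F_def last_labels_def)
  have M: "M = {2..n}" "finite M" by (auto simp: M_def X_def)
  have A: "A \<subseteq> X - {1}" "Max A \<in> A" if "A \<in> Pow M - {{}}" for A
    using that M(2) by (auto simp: M_def intro!: Max_in dest: finite_subset[rotated])
  have trees: "int (card (trees_with_star X F 1 (Max A) A)) = P A" if "A \<in> Pow M - {{}}" for A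
    unfolding P_def d_def M_def by (rule card_trees_with_star[OF X A[OF that] F])
  have fin: "finite (trees_with_star X F 1 (Max A) A)" if "A \<in> Pow M - {{}}" for A
  proof -
    have "finite (star_choices X F 1 (Max A) A v)" for v
      using X(1) by (simp add: star_choices_def)
    then have "finite (parent_maps (X - {Max A}) (star_choices X F 1 (Max A) A))"
      using X(1) by (intro finite_parent_maps) auto
    then show ?thesis
      using bij_betw_finite[OF bij_betw_trees_with_star[OF X A[OF that] F]] by blast
  qed
  have "card (uprooted_trees_avoiding n l) =
      card (SIGMA A:Pow M - {{}}. trees_with_star X F 1 (Max A) A)"
    using bij_betw_same_card[OF bij_betw_uprooted_trees_avoiding[of n l]] assms(1)
    by (simp add: M(1) X_def F_def)
  also have "int \<dots> = (\<Sum>A\<in>Pow M - {{}}. P A)"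
    using fin M trees by (subst card_SigmaI) (auto intro!: sum.cong)
  \<comment> \<open>The empty set is no star, but its term is the only one that survives.\<close>
  also have "\<dots> = (\<Sum>A\<in>Pow M. P A) - P {}"
    using M by (subst sum.remove[of "Pow M" "{}"]) auto
  also have "(\<Sum>A\<in>Pow M. P A) = 0"
    unfolding P_def by (rule sum_over_subsets_vanishes) (use M in auto)
  also have "P {} = - (\<Sum>w\<in>M - F. \<Prod>v\<in>M - {w}. d v)" by (simp add: P_def)
  also have "(\<Sum>w\<in>M - F. \<Prod>v\<in>M - {w}. d v) =
      (\<Sum>w\<in>M - F. (int n - 1) ^ (n - l - 2) * (int n - 2) ^ l)"
  proof (rule sum.cong[OF refl])
    fix w assume w: "w \<in> M - F"
    have "M - F = {2..n - l}" using assms by (auto simp: M F_def last_labels_def)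
    then have "card (M - F - {w}) = n - l - 2" using w by simp
    moreover have "card F = l" using assms by (simp add: F_def last_labels_def)
    moreover have "M - {w} = (M - F - {w}) \<union> F" using w F by (auto simp: M_def)
    moreover have "finite F" by (simp add: F_def last_labels_def)
    moreover have "(\<Prod>v\<in>(M - F - {w}) \<union> F. d v) = (\<Prod>v\<in>M - F - {w}. d v) * (\<Prod>v\<in>F. d v)"
      using M \<open>finite F\<close> by (intro prod.union_disjoint) auto
    ultimately show "(\<Prod>v\<in>M - {w}. d v) = (int n - 1) ^ (n - l - 2) * (int n - 2) ^ l"
      by (simp add: d_def X_def)
  qed
  also have "M - F = {2..n - l}" using assms by (auto simp: M F_def last_labels_def)
  finally have "int (card (uprooted_trees_avoiding n l)) =
      int (n - l - 1) * ((int n - 1) ^ (n - l - 2) * (int n - 2) ^ l)" by simp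
  also have "\<dots> = int ((n - 1) ^ (n - l - 2) * (n - 2) ^ l * (n - l - 1))"
    using assms by (simp add: of_nat_diff)
  finally show ?thesis by (simp only: of_nat_eq_iff)
qed

end
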